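(* Let $d\ge1$ and let $T=T(z)$ be the formal power series with $T(0)=1$ and $T=1+zT^{2d}$. Let $X=X(z)$ denote any of the $2d-1$ small solutions of the characteristic equation $1=zT^{2d-1}\sum_{\ell=1}^{d}(X^{2\ell-1}+X^{-2\ell+1})$. Then the recurrence relation $$T_j=1+z\prod_{\ell=1}^{d}\big(T_{j+2\ell-1}\,T_{j-2\ell+1}\big),\qquad j\in\mathbb{Z},$$ admits the solution with free parameter $\lambda$ $$T_j=T\cdot\frac{(1-\lambda X^{d+1+j})(1-\lambda X^{3d+4+j})}{(1-\lambda X^{d+3+j})(1-\lambda X^{3d+2+j})},\qquad j\in\mathbb{Z}.$$ Here $\lambda$ is any element, independent of $j$, of the field of Puiseux series in $z$ such that $1-\lambda X^k\ne0$ for all $k\in\mathbb{Z}$.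
   Context: All identities are in the field $K=\bigcup_{m\ge1}\mathbb{C}((z^{1/m}))$ of Puiseux series. A small solution of the characteristic equation is a solution $X\in K$ of positive order in $z$ (i.e. tending to $0$ as $z\to0$); there are $2d-1$ of them. *)

theory Defs
  imports "HOL-Computational_Algebra.Computational_Algebra"
begin

unbundle fps_syntax

text \<open>
  A Puiseux series is represented by its coefficient function on rational exponents.
  For \<open>m > 0\<close>, \<open>ramify m F q\<close> is the coefficient of \<open>z^q\<close> in \<open>F(z^(1/m))\<close>, so that
  \<open>range (ramify m)\<close> is the field of formal Laurent series in \<open>z^(1/m)\<close>.
\<close>

definition ramify :: "nat \<Rightarrow> complex fls \<Rightarrow> rat \<Rightarrow> complex" where
  "ramify m F q = (if q * of_nat m \<in> \<int> then F $$ \<lfloor>q * of_nat m\<rfloor> else 0)"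

typedef puiseux = "\<Union>m\<in>{1::nat..}. range (ramify m)"
  morphisms puiseux_nth Abs_puiseux
  by auto

setup_lifting type_definition_puiseux

definition convolve :: "(rat \<Rightarrow> complex) \<Rightarrow> (rat \<Rightarrow> complex) \<Rightarrow> rat \<Rightarrow> complex" where
  "convolve f g q = (\<Sum>a | f a \<noteq> 0 \<and> g (q - a) \<noteq> 0. f a * g (q - a))"

lemma ramify_nth [simp]: "m > 0 \<Longrightarrow> ramify m F (of_int k / of_nat m) = F $$ k"
  by (simp add: ramify_def)

lemma ramify_eq_0:
  assumes "\<And>k. q \<noteq> of_int k / of_nat m" "m > 0"
  shows   "ramify m F q = 0"
proof -
  have "q * of_nat m \<notin> \<int>"
  proof
    assume "q * of_nat m \<in> \<int>"
    then obtain k where "q * of_nat m = of_int k" by (elim Ints_cases)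
    with assms(2) have "q = of_int k / of_nat m" by (simp add: field_simps)
    with assms(1) show False by blast
  qed
  thus ?thesis by (simp add: ramify_def)
qed

lemma ramify_ext:
  assumes "m > 0" "\<And>k. f (of_int k / of_nat m) = F $$ k"
    and "\<And>q. (\<And>k. q \<noteq> of_int k / of_nat m) \<Longrightarrow> f q = 0"
  shows   "f = ramify m F"
proof
  fix q
  show "f q = ramify m F q"
  proof (cases "\<exists>k. q = of_int k / of_nat m")
    case True
    then obtain k where "q = of_int k / of_nat m" by blast
    thus ?thesis using assms(1,2) by simp
  next
    case False
    thus ?thesis using assms(1,3) ramify_eq_0 by auto
  qed
qed

lemma ramify_inj: "m > 0 \<Longrightarrow> ramify m F = ramify m G \<longleftrightarrow> F = G"
  by (metis ramify_nth fls_eq_iff)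

lemma ramify_compose_power:
  assumes "m > 0" "k > 0"
  shows   "ramify m F = ramify (m * k) (fls_compose_power F k)"
proof (rule ramify_ext)
  fix n :: int
  show "ramify m F (of_int n / of_nat (m * k)) = fls_compose_power F k $$ n"
  proof (cases "int k dvd n")
    case True
    then obtain r where r: "n = int k * r" by (elim dvdE)
    hence eq: "(of_int n / of_nat (m * k) :: rat) = of_int r / of_nat m"
      using assms by simp
    show ?thesis
      unfolding eq using assms r by (simp add: fls_nth_compose_power)
  next
    case False
    have "(of_int n / of_nat (m * k) :: rat) \<noteq> of_int r / of_nat m" for r
    proof
      assume "(of_int n / of_nat (m * k) :: rat) = of_int r / of_nat m"
      hence "(of_int n :: rat) = of_int (int k * r)"
        using assms by (simp add: field_simps)
      hence "n = int k * r" by (simp only: of_int_eq_iff)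
      with False show False by simp
    qed
    hence "ramify m F (of_int n / of_nat (m * k)) = 0"
      using assms by (intro ramify_eq_0) auto
    thus ?thesis using assms False by (simp add: fls_nth_compose_power)
  qed
next
  fix q :: rat
  assume *: "\<And>n. q \<noteq> of_int n / of_nat (m * k)"
  have "q \<noteq> of_int r / of_nat m" for r
    using *[of "int k * r"] assms by simp
  thus "ramify m F q = 0" using assms by (intro ramify_eq_0) auto
qed (use assms in simp)

lemma ramify_add:
  "m > 0 \<Longrightarrow> (\<lambda>q. ramify m F q + ramify m G q) = ramify m (F + G)"
  by (auto simp: ramify_def)

lemma ramify_diff:
  "m > 0 \<Longrightarrow> (\<lambda>q. ramify m F q - ramify m G q) = ramify m (F - G)"
  by (auto simp: ramify_def)

lemma ramify_uminus: "(\<lambda>q. - ramify m F q) = ramify m (- F)"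
  by (auto simp: ramify_def)

lemma ramify_0: "ramify m 0 = (\<lambda>_. 0)"
  by (auto simp: ramify_def)

lemma ramify_1: "m > 0 \<Longrightarrow> ramify m 1 = (\<lambda>q. if q = 0 then 1 else 0)"
proof (rule sym, rule ramify_ext)
  fix q :: rat assume "\<And>k. q \<noteq> of_int k / of_nat m"
  from this[of 0] show "(if q = 0 then 1 else 0 :: complex) = 0" by simp
qed auto

lemma ramify_mult:
  assumes "m > 0"
  shows   "convolve (ramify m F) (ramify m G) = ramify m (F * G)"
proof (rule ramify_ext)
  fix n :: int
  let ?f = "ramify m F" and ?g = "ramify m G"
  let ?h = "\<lambda>i::int. (of_int i / of_nat m :: rat)"
  have inj: "inj_on ?h A" for A using assms by (auto simp: inj_on_def)
  have diff: "?h n - ?h i = ?h (n - i)" for i by (simp add: diff_divide_distrib)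
  let ?I = "{i. F $$ i \<noteq> 0 \<and> G $$ (n - i) \<noteq> 0}"
  have eq: "{a. ?f a \<noteq> 0 \<and> ?g (?h n - a) \<noteq> 0} = ?h ` ?I"
  proof (intro equalityI subsetI)
    fix a assume a: "a \<in> {a. ?f a \<noteq> 0 \<and> ?g (?h n - a) \<noteq> 0}"
    then obtain i where i: "a = ?h i" using assms ramify_eq_0[of a m F] by blast
    from a have "?f (?h i) \<noteq> 0 \<and> ?g (?h n - ?h i) \<noteq> 0"
      unfolding i by (rule CollectD)
    hence "i \<in> ?I" unfolding diff ramify_nth[OF assms] by (rule CollectI)
    thus "a \<in> ?h ` ?I" using i by blast
  next
    fix a assume "a \<in> ?h ` ?I"
    then obtain i where "a = ?h i" "i \<in> ?I" by blast
    thus "a \<in> {a. ?f a \<noteq> 0 \<and> ?g (?h n - a) \<noteq> 0}"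
      using assms by (simp only: mem_Collect_eq diff ramify_nth simp_thms)
  qed
  have "convolve ?f ?g (?h n) = (\<Sum>i\<in>?I. F $$ i * G $$ (n - i))"
    unfolding convolve_def eq using assms
    by (subst sum.reindex[OF inj]) (simp only: o_def diff ramify_nth)
  also have "\<dots> = (\<Sum>i=fls_subdegree F..n - fls_subdegree G. F $$ i * G $$ (n - i))"
  proof (rule sum.mono_neutral_left)
    show "?I \<subseteq> {fls_subdegree F..n - fls_subdegree G}"
    proof
      fix i assume "i \<in> ?I"
      hence "fls_subdegree F \<le> i" "fls_subdegree G \<le> n - i"
        using fls_subdegree_leI by auto
      thus "i \<in> {fls_subdegree F..n - fls_subdegree G}" by simp
    qed
  qed auto
  also have "\<dots> = (F * G) $$ n" by (simp add: fls_times_nth(2))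
  finally show "convolve ?f ?g (?h n) = (F * G) $$ n" .
next
  fix q :: rat assume q: "\<And>k. q \<noteq> of_int k / of_nat m"
  have "\<not> (ramify m F a \<noteq> 0 \<and> ramify m G (q - a) \<noteq> 0)" for a
  proof
    assume "ramify m F a \<noteq> 0 \<and> ramify m G (q - a) \<noteq> 0"
    then obtain i j where "a = of_int i / of_nat m" "q - a = of_int j / of_nat m"
      using assms ramify_eq_0 by meson
    hence "q = of_int (i + j) / of_nat m" by (simp add: add_divide_distrib algebra_simps)
    with q show False by blast
  qed
  thus "convolve (ramify m F) (ramify m G) q = 0"
    unfolding convolve_def by (intro sum.neutral) blast
qed (use assms in auto)

lemma ramify_common2:
  assumes "f \<in> (\<Union>m\<in>{1::nat..}. range (ramify m))" "g \<in> (\<Union>m\<in>{1::nat..}. range (ramify m))"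
  obtains m F G where "m > 0" "f = ramify m F" "g = ramify m G"
proof -
  from assms obtain a b F G where *: "a > 0" "b > 0" "f = ramify a F" "g = ramify b G"
    by (auto simp: Suc_le_eq)
  show ?thesis
  proof (rule that)
    show "f = ramify (a * b) (fls_compose_power F b)"
      using *(3) ramify_compose_power[OF *(1,2)] by (rule trans)
    show "g = ramify (a * b) (fls_compose_power G a)"
      using *(4) ramify_compose_power[OF *(2,1)] unfolding mult.commute[of a b] by (rule trans)
  qed (use * in auto)
qed

lemma ramify_memI: "m > 0 \<Longrightarrow> ramify m F \<in> (\<Union>m\<in>{1::nat..}. range (ramify m))"
  by (intro UN_I[of m] rangeI) simp

instantiation puiseux :: "{zero, one, plus, minus, uminus, times, inverse}"
begin

lift_definition zero_puiseux :: puiseux is "\<lambda>_. 0"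
  using ramify_memI[of 1 0] by (simp add: ramify_0)

lift_definition one_puiseux :: puiseux is "\<lambda>q. if q = 0 then 1 else 0"
  using ramify_memI[of 1 1] by (simp add: ramify_1)

lift_definition plus_puiseux :: "puiseux \<Rightarrow> puiseux \<Rightarrow> puiseux" is "\<lambda>f g q. f q + g q"
  by (erule (1) ramify_common2) (metis ramify_add ramify_memI)

lift_definition minus_puiseux :: "puiseux \<Rightarrow> puiseux \<Rightarrow> puiseux" is "\<lambda>f g q. f q - g q"
  by (erule (1) ramify_common2) (metis ramify_diff ramify_memI)

lift_definition uminus_puiseux :: "puiseux \<Rightarrow> puiseux" is "\<lambda>f q. - f q"
proof -
  fix f assume f: "f \<in> (\<Union>m\<in>{1::nat..}. range (ramify m))"
  show "(\<lambda>q. - f q) \<in> (\<Union>m\<in>{1::nat..}. range (ramify m))"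
    by (rule ramify_common2[OF f f]) (metis ramify_uminus ramify_memI)
qed

lift_definition times_puiseux :: "puiseux \<Rightarrow> puiseux \<Rightarrow> puiseux" is convolve
  by (erule (1) ramify_common2) (metis ramify_mult ramify_memI)

definition inverse_puiseux :: "puiseux \<Rightarrow> puiseux" where
  "inverse_puiseux f = (if f = 0 then 0 else THE g. f * g = 1)"

definition divide_puiseux :: "puiseux \<Rightarrow> puiseux \<Rightarrow> puiseux" where
  "divide_puiseux f g = f * inverse g"

instance ..

end

text \<open>\<open>puiseux_of_fls m F\<close> is \<open>F(z^(1/m))\<close>; it is meaningful only for \<open>m > 0\<close>.\<close>

definition puiseux_of_fls :: "nat \<Rightarrow> complex fls \<Rightarrow> puiseux" where
  "puiseux_of_fls m F = Abs_puiseux (ramify m F)"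

lemma puiseux_nth_of_fls: "m > 0 \<Longrightarrow> puiseux_nth (puiseux_of_fls m F) = ramify m F"
  unfolding puiseux_of_fls_def by (intro Abs_puiseux_inverse ramify_memI)

lemma puiseux_of_fls_0: "m > 0 \<Longrightarrow> puiseux_of_fls m 0 = 0"
  by (simp add: puiseux_nth_inject[symmetric] puiseux_nth_of_fls zero_puiseux.rep_eq ramify_0)

lemma puiseux_of_fls_1: "m > 0 \<Longrightarrow> puiseux_of_fls m 1 = 1"
  by (simp add: puiseux_nth_inject[symmetric] puiseux_nth_of_fls one_puiseux.rep_eq ramify_1)

lemma puiseux_of_fls_add:
  "m > 0 \<Longrightarrow> puiseux_of_fls m (F + G) = puiseux_of_fls m F + puiseux_of_fls m G"
  by (simp add: puiseux_nth_inject[symmetric] puiseux_nth_of_fls plus_puiseux.rep_eq ramify_add)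

lemma puiseux_of_fls_diff:
  "m > 0 \<Longrightarrow> puiseux_of_fls m (F - G) = puiseux_of_fls m F - puiseux_of_fls m G"
  by (simp add: puiseux_nth_inject[symmetric] puiseux_nth_of_fls minus_puiseux.rep_eq ramify_diff)

lemma puiseux_of_fls_uminus:
  "m > 0 \<Longrightarrow> puiseux_of_fls m (- F) = - puiseux_of_fls m F"
  by (simp add: puiseux_nth_inject[symmetric] puiseux_nth_of_fls uminus_puiseux.rep_eq ramify_uminus)

lemma puiseux_of_fls_mult:
  "m > 0 \<Longrightarrow> puiseux_of_fls m (F * G) = puiseux_of_fls m F * puiseux_of_fls m G"
  by (simp add: puiseux_nth_inject[symmetric] puiseux_nth_of_fls times_puiseux.rep_eq ramify_mult)

lemma puiseux_of_fls_inject: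
  "m > 0 \<Longrightarrow> puiseux_of_fls m F = puiseux_of_fls m G \<longleftrightarrow> F = G"
  by (simp add: puiseux_nth_inject[symmetric] puiseux_nth_of_fls ramify_inj)

lemma puiseux_of_fls_compose_power:
  "m > 0 \<Longrightarrow> k > 0 \<Longrightarrow> puiseux_of_fls (m * k) (fls_compose_power F k) = puiseux_of_fls m F"
  unfolding puiseux_of_fls_def by (metis ramify_compose_power)

lemma puiseux_cases2:
  obtains m F G where "m > 0" "f = puiseux_of_fls m F" "g = puiseux_of_fls m G"
proof (rule ramify_common2[OF puiseux_nth puiseux_nth, of f g])
  fix m F G
  assume "m > 0" "puiseux_nth f = ramify m F" "puiseux_nth g = ramify m G"
  thus ?thesis
    by (intro that[of m F G]) (simp_all add: puiseux_nth_inject[symmetric] puiseux_nth_of_fls)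
qed

lemma puiseux_cases3:
  obtains m F G H where "m > 0"
    "f = puiseux_of_fls m F" "g = puiseux_of_fls m G" "h = puiseux_of_fls m H"
proof -
  obtain a F G where 1: "a > 0" "f = puiseux_of_fls a F" "g = puiseux_of_fls a G"
    by (rule puiseux_cases2[of f g])
  obtain b H where 2: "b > 0" "h = puiseux_of_fls b H"
    using puiseux_cases2[of h h] by metis
  show ?thesis
  proof (rule that)
    show "a * b > 0" using 1 2 by simp
    show "f = puiseux_of_fls (a * b) (fls_compose_power F b)"
         "g = puiseux_of_fls (a * b) (fls_compose_power G b)"
      unfolding 1(2,3) puiseux_of_fls_compose_power[OF 1(1) 2(1)] by (rule refl)+
    show "h = puiseux_of_fls (a * b) (fls_compose_power H a)"
      unfolding 2(2) mult.commute[of a b] puiseux_of_fls_compose_power[OF 2(1) 1(1)] by (rule refl)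
  qed
qed

lemmas puiseux_of_fls_hom =
  puiseux_of_fls_add puiseux_of_fls_diff puiseux_of_fls_uminus puiseux_of_fls_mult

instance puiseux :: comm_ring_1
proof
  fix a b c :: puiseux
  obtain m A B C where m: "m > 0" and abc:
    "a = puiseux_of_fls m A" "b = puiseux_of_fls m B" "c = puiseux_of_fls m C"
    by (rule puiseux_cases3[of a b c])
  note eqs = abc puiseux_of_fls_hom[OF m, symmetric]
    puiseux_of_fls_0[OF m, symmetric] puiseux_of_fls_1[OF m, symmetric]
    puiseux_of_fls_inject[OF m]
  show "a * b * c = a * (b * c)" "a * b = b * a" "1 * a = a"
    "a + b + c = a + (b + c)" "a + b = b + a" "0 + a = a" "- a + a = 0" "a - b = a + - b"
    "(a + b) * c = a * c + b * c"
    unfolding eqs by (simp_all add: algebra_simps)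
  show "(0 :: puiseux) \<noteq> 1" unfolding eqs by simp
qed

instance puiseux :: field
proof
  fix a b :: puiseux
  show "a div b = a * inverse b" by (rule divide_puiseux_def)
  show "inverse (0 :: puiseux) = 0" by (simp add: inverse_puiseux_def)
  assume a: "a \<noteq> 0"
  obtain m A where m: "m > 0" and A: "a = puiseux_of_fls m A"
    using puiseux_cases2[of a a] by metis
  have "A \<noteq> 0" using a A m by (auto simp: puiseux_of_fls_0)
  hence "A * inverse A = 1" by simp
  hence 1: "a * puiseux_of_fls m (inverse A) = 1"
    by (simp only: A puiseux_of_fls_mult[OF m, symmetric] puiseux_of_fls_1[OF m])
  have "(THE g. a * g = 1) = puiseux_of_fls m (inverse A)"
  proof (rule the_equality)
    fix g assume g: "a * g = 1"
    have "g = (a * puiseux_of_fls m (inverse A)) * g" by (simp only: 1 mult_1_left)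
    also have "\<dots> = (a * g) * puiseux_of_fls m (inverse A)" by (simp only: mult_ac)
    finally show "g = puiseux_of_fls m (inverse A)" by (simp only: g mult_1_left)
  qed (fact 1)
  thus "inverse a * a = 1" using a 1 by (simp add: inverse_puiseux_def mult.commute)
qed

text \<open>
  The exponent of the leading term. As for \<^const>\<open>fls_subdegree\<close>, the zero series gets the
  value \<open>0\<close>; hence \<open>puiseux_order f > 0\<close> implies \<open>f \<noteq> 0\<close>.
\<close>

definition puiseux_order :: "puiseux \<Rightarrow> rat" where
  "puiseux_order f = (if f = 0 then 0 else LEAST q. puiseux_nth f q \<noteq> 0)"

lemma puiseux_order_of_fls:
  assumes "m > 0"
  shows   "puiseux_order (puiseux_of_fls m F) = of_int (fls_subdegree F) / of_nat m"
proof (cases "F = 0")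
  case True
  thus ?thesis using assms by (simp add: puiseux_order_def puiseux_of_fls_0)
next
  case False
  hence "puiseux_of_fls m F \<noteq> 0"
    using assms by (metis puiseux_of_fls_0 puiseux_of_fls_inject)
  moreover have "(LEAST q. ramify m F q \<noteq> 0) = of_int (fls_subdegree F) / of_nat m"
  proof (rule Least_equality)
    show "ramify m F (of_int (fls_subdegree F) / of_nat m) \<noteq> 0"
      using assms False by simp
  next
    fix q assume q: "ramify m F q \<noteq> 0"
    then obtain k where k: "q = of_int k / of_nat m"
      using assms ramify_eq_0 by blast
    hence "F $$ k \<noteq> 0" using q assms by simp
    hence "fls_subdegree F \<le> k" by (rule fls_subdegree_leI)
    thus "of_int (fls_subdegree F) / of_nat m \<le> q"
      unfolding k by (intro divide_right_mono) auto
  qed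
  ultimately show ?thesis
    using assms by (simp add: puiseux_order_def puiseux_nth_of_fls)
qed

definition puiseux_of_fps :: "complex fps \<Rightarrow> puiseux" where
  "puiseux_of_fps F = puiseux_of_fls 1 (fps_to_fls F)"

definition puiseux_z :: puiseux where
  "puiseux_z = puiseux_of_fps fps_X"

definition small_solution :: "nat \<Rightarrow> complex fps \<Rightarrow> puiseux \<Rightarrow> bool" where
  "small_solution d T X \<longleftrightarrow>
     puiseux_order X > 0 \<and>
     1 = puiseux_z * puiseux_of_fps T ^ (2 * d - 1) *
           (\<Sum>l=1..d. X powi (2 * int l - 1) + X powi (- 2 * int l + 1))"

definition solves_recurrence :: "nat \<Rightarrow> (int \<Rightarrow> puiseux) \<Rightarrow> bool" where
  "solves_recurrence d S \<longleftrightarrow>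
     (\<forall>j. S j = 1 + puiseux_z * (\<Prod>l=1..d. S (j + 2 * int l - 1) * S (j - 2 * int l + 1)))"

end

theory Submission
  imports Defs
begin

text \<open>
  Put \<open>u k = 1 - \<lambda> X^k\<close>. In the product over \<open>l\<close> both quotients of \<open>T\<^sub>j\<close> telescope, and what
  remains of the recurrence is a three-term relation between products \<open>u a * u b\<close> with the same
  index sum. As a polynomial in \<open>\<lambda>\<close>, its constant and quadratic coefficients are the equation
  \<open>T = 1 + z T^(2d)\<close>, and its linear coefficient is a multiple of the characteristic equation
  with the geometric sum in \<open>X^2\<close> evaluated.
\<close>

lemma puiseux_of_fps_add: "puiseux_of_fps (F + G) = puiseux_of_fps F + puiseux_of_fps G"
  by (simp add: puiseux_of_fps_def puiseux_of_fls_add fps_to_fls_plus)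

lemma puiseux_of_fps_mult: "puiseux_of_fps (F * G) = puiseux_of_fps F * puiseux_of_fps G"
  by (simp add: puiseux_of_fps_def puiseux_of_fls_mult fls_times_fps_to_fls)

lemma puiseux_of_fps_1: "puiseux_of_fps 1 = 1"
  by (simp add: puiseux_of_fps_def puiseux_of_fls_1)

lemma puiseux_of_fps_power: "puiseux_of_fps (F ^ n) = puiseux_of_fps F ^ n"
  by (induction n) (simp_all add: puiseux_of_fps_1 puiseux_of_fps_mult)

text \<open>Multiplying by \<open>1 - X\<^sup>2\<close> makes both geometric progressions telescope
  and avoids a division, so \<open>X\<^sup>2 = 1\<close> needs no separate case.\<close>

lemma odd_powi_sum:
  fixes X :: "'a::field"
  assumes "X \<noteq> 0"
  shows "(1 - X\<^sup>2) * (\<Sum>l=1..d. X powi (2 * int l - 1) + X powi (- 2 * int l + 1)) =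
    X powi (1 - 2 * int d) - X powi (2 * int d + 1)"
proof (induction d)
  case (Suc d)
  have shift: "X\<^sup>2 * X powi k = X powi (k + 2)" for k :: int
    using assms by (simp add: power_int_add)
  have "(1 - X\<^sup>2) * (X powi (2 * int d + 1) + X powi (- 1 - 2 * int d)) =
      X powi (2 * int d + 1) - X powi (2 * int d + 3)
      + X powi (- 1 - 2 * int d) - X powi (1 - 2 * int d)"
    by (simp add: algebra_simps shift)
  with Suc show ?case
    by (simp add: distrib_left algebra_simps)
qed simp

text \<open>Two chains of step 2: the first quotients collapse to
  \<open>f (k + 1) / f (k + 2 * int d + 1)\<close>, the second to
  \<open>f (k - 2 * int d + 1) / f (k + 1)\<close>, and \<open>f (k + 1)\<close> cancels between
  them.\<close>

lemma prod_odd_shifts_telescope: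
  fixes f :: "int \<Rightarrow> 'a::field"
  assumes "\<And>k. f k \<noteq> 0"
  shows "(\<Prod>l=1..d. (f (k + 2 * int l - 1) / f (k + 2 * int l + 1)) *
      (f (k - 2 * int l + 1) / f (k - 2 * int l + 3))) =
    f (k - 2 * int d + 1) / f (k + 2 * int d + 1)"
proof (induction d)
  case (Suc d)
  show ?case
    unfolding prod.atLeast1_atMost_eq
    using Suc assms by (simp add: prod.atLeast1_atMost_eq field_simps)
qed (use assms in simp)

text \<open>All three index pairs sum to \<open>2 * j + 4 * int d + 5\<close>, so the constant and
  quadratic coefficients in \<open>lam\<close> impose the same condition. The hypothesis
  \<open>char\<close> is the characteristic equation times \<open>1 - X\<^sup>2\<close>.\<close>

lemma three_term_relation:
  fixes X lam z T :: "'a::field"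
  assumes "X \<noteq> 0" "d \<ge> 1"
    and T: "T = 1 + z * T ^ (2 * d)"
    and char: "1 - X\<^sup>2 = z * T ^ (2 * d - 1) * (X powi (1 - 2 * int d) - X powi (2 * int d + 1))"
  defines "u \<equiv> \<lambda>k. 1 - lam * X powi k"
  shows "T * (u (j + int d + 1) * u (j + 3 * int d + 4)) =
    u (j + int d + 3) * u (j + 3 * int d + 2)
    + z * T ^ (2 * d) * (u (j - int d + 2) * u (j + 5 * int d + 3))"
proof -
  define w where "w = z * T ^ (2 * d)"
  \<comment> \<open>\<open>a\<close> and \<open>b\<close> absorb the symbolic exponents
    \<open>j\<close> and \<open>d\<close>; the claim then involves only numeral exponents and can be
    checked as a polynomial identity.\<close>
  define a where "a = X powi j"
  define b where "b = X ^ d"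
  have nz: "a \<noteq> 0" "b \<noteq> 0"
    using assms(1) by (simp_all add: a_def b_def)
  have b: "X powi (m * int d) = b powi m" for m
    by (metis b_def mult.commute power_int_mult power_int_of_nat)
  have Tw: "T = 1 + w"
    using T by (simp add: w_def)
  \<comment> \<open>The truncated subtraction in \<open>2 * d - 1\<close> is harmless because
    \<open>d \<ge> 1\<close>.\<close>
  have "T * (z * T ^ (2 * d - 1)) = w"
    using \<open>d \<ge> 1\<close> by (simp add: w_def power_eq_if[of T "2 * d"])
  hence "T * (1 - X\<^sup>2) = w * (X powi (1 - 2 * int d) - X powi (2 * int d + 1))"
    unfolding char by (simp only: mult.assoc[symmetric])
  hence "(1 + w) * (1 - X\<^sup>2) = w * (X / b\<^sup>2 - b\<^sup>2 * X)"
    using assms(1) b by (simp add: Tw power_int_add power_int_diff)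
  hence char': "(1 + w) * (1 - X\<^sup>2) * b\<^sup>2 = w * (X - b ^ 4 * X)"
    using nz by (simp add: field_simps power2_eq_square power4_eq_xxxx)
  have u: "u (j + int d + 1) = 1 - lam * a * b * X"
    "u (j + 3 * int d + 4) = 1 - lam * a * b ^ 3 * X ^ 4"
    "u (j + int d + 3) = 1 - lam * a * b * X ^ 3"
    "u (j + 3 * int d + 2) = 1 - lam * a * b ^ 3 * X ^ 2"
    "u (j - int d + 2) = 1 - lam * a * X ^ 2 / b"
    "u (j + 5 * int d + 3) = 1 - lam * a * b ^ 5 * X ^ 3"
    using assms(1) b
    by (simp_all add: u_def power_int_add power_int_diff a_def[symmetric] b_def[symmetric])
  \<comment> \<open>The factor \<open>b\<close> clears the only denominator, that of
    \<open>u (j - int d + 2)\<close>. The right-hand side isolates the difference of the two sides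
    of \<open>char'\<close>, with its explicit cofactor.\<close>
  have "b * ((1 + w) * ((1 - lam * a * b * X) * (1 - lam * a * b ^ 3 * X ^ 4))
      - (1 - lam * a * b * X ^ 3) * (1 - lam * a * b ^ 3 * X ^ 2))
      - w * ((b - lam * a * X ^ 2) * (1 - lam * a * b ^ 5 * X ^ 3))
    = - lam * a * X * (1 - b\<^sup>2 * X) * ((1 + w) * (1 - X\<^sup>2) * b\<^sup>2 - w * (X - b ^ 4 * X))"
    by algebra
  hence "b * ((1 + w) * ((1 - lam * a * b * X) * (1 - lam * a * b ^ 3 * X ^ 4))
      - (1 - lam * a * b * X ^ 3) * (1 - lam * a * b ^ 3 * X ^ 2))
    = w * ((b - lam * a * X ^ 2) * (1 - lam * a * b ^ 5 * X ^ 3))"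
    by (simp only: char' diff_self mult_zero_right right_minus_eq)
  also have "b - lam * a * X ^ 2 = b * (1 - lam * a * X ^ 2 / b)"
    using nz by (simp add: right_diff_distrib)
  finally have "(1 + w) * ((1 - lam * a * b * X) * (1 - lam * a * b ^ 3 * X ^ 4))
      - (1 - lam * a * b * X ^ 3) * (1 - lam * a * b ^ 3 * X ^ 2)
    = w * ((1 - lam * a * X ^ 2 / b) * (1 - lam * a * b ^ 5 * X ^ 3))"
    using nz by simp
  thus ?thesis
    unfolding u w_def[symmetric] unfolding Tw by (simp add: diff_eq_eq add.commute)
qed

theorem lemma4:
  fixes d :: nat and T :: "complex fps" and X lam :: puiseux
  assumes "d \<ge> 1"
    and "fps_nth T 0 = 1"
    and "T = 1 + fps_X * T ^ (2 * d)"
    and "small_solution d T X"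
    and "\<forall>k::int. 1 - lam * X powi k \<noteq> 0"
  shows "solves_recurrence d (\<lambda>j.
           puiseux_of_fps T *
             (((1 - lam * X powi (int d + 1 + j)) * (1 - lam * X powi (3 * int d + 4 + j))) /
              ((1 - lam * X powi (int d + 3 + j)) * (1 - lam * X powi (3 * int d + 2 + j)))))"
proof -
  define t where "t = puiseux_of_fps T"
  define z where "z = puiseux_z"
  define u where "u = (\<lambda>k. 1 - lam * X powi k)"
  define v where "v = (\<lambda>k. inverse (u k))"
  define S where "S = (\<lambda>j. t * ((u (int d + 1 + j) * u (3 * int d + 4 + j)) /
    (u (int d + 3 + j) * u (3 * int d + 2 + j))))"
  have u_nz: "u k \<noteq> 0" for k
    using assms(5) by (simp add: u_def)
  hence v_nz: "v k \<noteq> 0" for k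
    by (simp add: v_def)
  \<comment> \<open>The zero series has order 0 by convention, so positive order excludes
    it.\<close>
  have "X \<noteq> 0"
    using assms(4) by (auto simp: small_solution_def puiseux_order_def)
  have t: "t = 1 + z * t ^ (2 * d)"
    unfolding t_def z_def puiseux_z_def
    by (subst assms(3)) (simp only: puiseux_of_fps_add puiseux_of_fps_mult
        puiseux_of_fps_power puiseux_of_fps_1)
  have eq: "1 = z * t ^ (2 * d - 1) *
      (\<Sum>l=1..d. X powi (2 * int l - 1) + X powi (- 2 * int l + 1))"
    using assms(4) by (simp only: small_solution_def z_def t_def)
  have "1 - X\<^sup>2 = (1 - X\<^sup>2) * (z * t ^ (2 * d - 1) *
      (\<Sum>l=1..d. X powi (2 * int l - 1) + X powi (- 2 * int l + 1)))"
    unfolding eq[symmetric] by simp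
  hence char: "1 - X\<^sup>2 =
      z * t ^ (2 * d - 1) * (X powi (1 - 2 * int d) - X powi (2 * int d + 1))"
    by (simp only: mult.left_commute[of "1 - X\<^sup>2"] odd_powi_sum[OF \<open>X \<noteq> 0\<close>])
  \<comment> \<open>Passing to the reciprocal \<open>v\<close> turns the second quotient around, so
    that both have the shape \<open>f k / f (k + 2)\<close> and one telescoping lemma serves for
    both.\<close>
  have S_eq: "S i = t * ((u (i + int d + 1) / u (i + int d + 3)) *
      (v (i + 3 * int d + 2) / v (i + 3 * int d + 4)))" for i
    by (simp add: S_def v_def add_ac divide_inverse mult_ac)
  have rec: "S j = 1 + z * (\<Prod>l=1..d. S (j + 2 * int l - 1) * S (j - 2 * int l + 1))" for j
  proof -
    define p where "p = (\<lambda>f k l. (f (k + 2 * int l - 1) / f (k + 2 * int l + 1)) *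
      (f (k - 2 * int l + 1) / f (k - 2 * int l + 3)) :: puiseux)"
    have factor: "S (j + 2 * int l - 1) * S (j - 2 * int l + 1) =
        t\<^sup>2 * (p u (j + int d + 1) l * p v (j + 3 * int d + 2) l)" for l
      by (simp add: S_eq p_def power2_eq_square mult_ac algebra_simps)
    have "(\<Prod>l=1..d. S (j + 2 * int l - 1) * S (j - 2 * int l + 1)) = t ^ (2 * d) *
        ((\<Prod>l=1..d. p u (j + int d + 1) l) * (\<Prod>l=1..d. p v (j + 3 * int d + 2) l))"
      unfolding factor by (simp add: prod.distrib power_mult)
    \<comment> \<open>The two denominators left after telescoping are exactly those of
      \<open>S j\<close>, so clearing them yields the three-term relation.\<close>
    also have "(\<Prod>l=1..d. p u (j + int d + 1) l) = u (j - int d + 2) / u (j + 3 * int d + 2)"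
      unfolding p_def prod_odd_shifts_telescope[of u, OF u_nz] by (simp add: algebra_simps)
    also have "(\<Prod>l=1..d. p v (j + 3 * int d + 2) l) = u (j + 5 * int d + 3) / u (j + int d + 3)"
      unfolding p_def prod_odd_shifts_telescope[of v, OF v_nz]
      by (simp add: v_def divide_inverse algebra_simps)
    finally have prod: "(\<Prod>l=1..d. S (j + 2 * int l - 1) * S (j - 2 * int l + 1)) =
        t ^ (2 * d) * (u (j - int d + 2) / u (j + 3 * int d + 2) *
          (u (j + 5 * int d + 3) / u (j + int d + 3)))" .
    have "t * (u (j + int d + 1) * u (j + 3 * int d + 4)) =
      u (j + int d + 3) * u (j + 3 * int d + 2)
      + z * t ^ (2 * d) * (u (j - int d + 2) * u (j + 5 * int d + 3))"
      unfolding u_def by (rule three_term_relation[OF \<open>X \<noteq> 0\<close> \<open>d \<ge> 1\<close> t char])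
    \<comment> \<open>Division of the three-term relation by \<open>C * D\<close>, stated for
      arbitrary values so that the indices play no part.\<close>
    moreover have "t * (A * B / (C * D)) = 1 + z * (t ^ (2 * d) * (E / D * (F / C)))"
      if "t * (A * B) = C * D + z * t ^ (2 * d) * (E * F)" "C \<noteq> 0" "D \<noteq> 0"
      for A B C D E F
    proof -
      have "t * (A * B / (C * D)) = (C * D + z * t ^ (2 * d) * (E * F)) / (C * D)"
        by (simp add: that(1)[symmetric])
      also have "\<dots> = 1 + z * (t ^ (2 * d) * (E / D * (F / C)))"
        using that(2,3) by (simp add: add_divide_distrib mult_ac)
      finally show ?thesis .
    qed
    ultimately show ?thesis
      unfolding prod using u_nz by (simp add: S_def add_ac)
  qed
  have "solves_recurrence d S"
    unfolding solves_recurrence_def using rec[unfolded z_def] by (rule allI)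
  thus ?thesis
    unfolding S_def u_def t_def .
qed

end
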